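(* Let $r \ge 2$, $d \ge 1$, $2 \le j \le r$ be integers, and let $N$ be an integer with $N+1 > \frac{r-1}{j-1}(d+1)$. Then for every affine map $f : \Delta_N \to \mathbb{R}^d$ there are $j$-wise disjoint faces $\sigma_1, \dots, \sigma_r$ of $\Delta_N$ such that $f(\sigma_1) \cap \dots \cap f(\sigma_r) \neq \emptyset$.
   Context: $\Delta_N$ denotes the $N$-dimensional simplex with $N+1$ vertices. A collection of faces $\sigma_1,\dots,\sigma_r$ is $j$-wise disjoint if the intersection of any $j$ of them is empty. *)

theory Defs
  imports "HOL-Analysis.Analysis"
begin

definition affine_map_on :: "'a::real_vector set \<Rightarrow> ('a \<Rightarrow> 'b::real_vector) \<Rightarrow> bool" where
  "affine_map_on S f \<longleftrightarrow>
     (\<forall>x\<in>S. \<forall>y\<in>S. \<forall>u\<ge>0. \<forall>v\<ge>0. u + v = 1 \<longrightarrow>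
        f (u *\<^sub>R x + v *\<^sub>R y) = u *\<^sub>R f x + v *\<^sub>R f y)"

text \<open>The family is indexed, so the same set may occur under several indices; ``any \<open>j\<close> of them''
  refers to \<open>j\<close> distinct indices.\<close>

definition wise_disjoint :: "nat \<Rightarrow> 'i set \<Rightarrow> ('i \<Rightarrow> 'a set) \<Rightarrow> bool" where
  "wise_disjoint j I \<sigma> \<longleftrightarrow> (\<forall>J\<subseteq>I. card J = j \<longrightarrow> (\<Inter>i\<in>J. \<sigma> i) = {})"

end

theory Submission
  imports Defs
begin

text \<open>Counting every vertex of the simplex with multiplicity \<open>j - 1\<close> gives more than \<open>(r - 1) (d + 1)\<close>
  points, so Tverberg's theorem yields a partition into \<open>r\<close> classes whose convex hulls have a common
  point; a vertex lies in at most \<open>j - 1\<close> classes. Tverberg's theorem itself follows Sarkaria: lift the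
  points to \<open>y\<^sub>i = (x\<^sub>i, 1)\<close> and apply the argument of Barany's colourful Caratheodory theorem to the sets
  \<open>{y\<^sub>i \<otimes> u\<^sub>k | k}\<close>, where \<open>u\<^sub>1, \<dots>, u\<^sub>r\<close> are vectors whose only linear relation is that they sum to zero.
  Among all colourings and convex weights, take one whose combination is closest to the origin. If the
  distance were positive, all chosen vectors would lie on a hyperplane, and a linear dependence among
  them would allow one weight to be made zero; recolouring that point then decreases the distance.\<close>

section \<open>Linear elimination and a first-order condition\<close>

text \<open>Gaussian elimination, one equation per induction step: an equation with a nonzero
  coefficient is solved for a pivot unknown \<open>p\<close>, which is then eliminated from the
  others.\<close>

lemma homogeneous_system_nontrivial_solution:
  fixes a :: "'e \<Rightarrow> 'i \<Rightarrow> 'k::field"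
  assumes "finite E" "finite I" "card E < card I"
  shows "\<exists>\<mu>. (\<exists>i\<in>I. \<mu> i \<noteq> 0) \<and> (\<forall>e\<in>E. (\<Sum>i\<in>I. \<mu> i * a e i) = 0)"
  using assms
proof (induction E arbitrary: a I rule: finite_induct)
  case empty
  then have "I \<noteq> {}" by auto
  then show ?case by (intro exI[of _ "\<lambda>_. 1"]) auto
next
  case (insert e E)
  show ?case
  proof (cases "\<forall>i\<in>I. a e i = 0")
    case True
    obtain \<mu> where \<mu>: "\<exists>i\<in>I. \<mu> i \<noteq> 0" "\<forall>e\<in>E. (\<Sum>i\<in>I. \<mu> i * a e i) = 0"
      using insert.IH[of I a] insert.prems insert.hyps by auto
    with True show ?thesis by (intro exI[of _ \<mu>]) auto
  next
    case False
    then obtain p where p: "p \<in> I" "a e p \<noteq> 0" by blast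
    define a' where "a' = (\<lambda>e' i. a e' i - a e' p / a e p * a e i)"
    have "card E < card (I - {p})"
      using insert.prems insert.hyps p by simp
    then obtain \<mu> where \<mu>: "\<exists>i\<in>I-{p}. \<mu> i \<noteq> 0" "\<forall>e\<in>E. (\<Sum>i\<in>I-{p}. \<mu> i * a' e i) = 0"
      using insert.IH[of "I - {p}" a'] insert.prems by auto
    define s where "s = (\<Sum>i\<in>I-{p}. \<mu> i * a e i)"
    \<comment> \<open>The value at \<open>p\<close> is the one forced by equation \<open>e\<close>
      once the other unknowns are fixed.\<close>
    define \<nu> where "\<nu> = \<mu>(p := - s / a e p)"
    have split: "(\<Sum>i\<in>I. \<nu> i * a e' i) = (\<Sum>i\<in>I-{p}. \<mu> i * a e' i) - s / a e p * a e' p" for e'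
    proof -
      have "(\<Sum>i\<in>I. \<nu> i * a e' i) = \<nu> p * a e' p + (\<Sum>i\<in>I-{p}. \<nu> i * a e' i)"
        using insert.prems p by (simp add: sum.remove)
      also have "(\<Sum>i\<in>I-{p}. \<nu> i * a e' i) = (\<Sum>i\<in>I-{p}. \<mu> i * a e' i)"
        by (rule sum.cong) (auto simp: \<nu>_def)
      finally show ?thesis by (simp add: \<nu>_def)
    qed
    have "(\<Sum>i\<in>I. \<nu> i * a e i) = 0"
      using split[of e] p by (simp add: s_def)
    moreover have "(\<Sum>i\<in>I. \<nu> i * a e' i) = 0" if "e' \<in> E" for e'
    proof -
      have "0 = (\<Sum>i\<in>I-{p}. \<mu> i * a' e' i)" using \<mu> that by simp
      also have "\<dots> = (\<Sum>i\<in>I-{p}. \<mu> i * a e' i) - a e' p / a e p * s"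
        unfolding a'_def s_def
        by (simp add: right_diff_distrib sum_subtractf sum_distrib_left mult_ac)
      finally show ?thesis unfolding split by (simp add: mult_ac)
    qed
    moreover have "\<exists>i\<in>I. \<nu> i \<noteq> 0" using \<mu>(1) by (auto simp: \<nu>_def)
    ultimately show ?thesis by blast
  qed
qed

text \<open>Divide by \<open>t\<close> and let \<open>t\<close> tend to zero. This extracts the sign
  of a directional derivative at a minimizer.\<close>

lemma nonneg_if_quadratic_nonneg:
  fixes a b :: real
  assumes "\<And>t. 0 < t \<Longrightarrow> t \<le> 1 \<Longrightarrow> 0 \<le> 2 * t * a + t\<^sup>2 * b"
  shows "0 \<le> a"
proof (rule ccontr)
  assume "\<not> 0 \<le> a"
  \<comment> \<open>Small enough that \<open>t * b\<close> is at most \<open>- a\<close>, so that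
    \<open>2 * a + t * b\<close> is at most \<open>a\<close> and hence negative.\<close>
  define t where "t = min 1 (- a / (\<bar>b\<bar> + 1))"
  have t: "0 < t" "t \<le> 1"
    using \<open>\<not> 0 \<le> a\<close> by (auto simp: t_def intro!: divide_neg_pos)
  have "t \<le> - a / (\<bar>b\<bar> + 1)" by (simp add: t_def)
  then have "t * (\<bar>b\<bar> + 1) \<le> - a" by (subst (asm) pos_le_divide_eq) auto
  have "t * b \<le> t * (\<bar>b\<bar> + 1)" using t by (intro mult_left_mono) auto
  then have "2 * a + t * b < 0"
    using \<open>t * (\<bar>b\<bar> + 1) \<le> - a\<close> \<open>\<not> 0 \<le> a\<close> by linarith
  then have "t * (2 * a + t * b) < 0" using t by (simp add: mult_pos_neg)
  with assms[OF t(1,2)] show False by (simp add: power2_eq_square algebra_simps)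
qed

section \<open>Convex weights\<close>

definition prob_weights :: "'i set \<Rightarrow> ('i \<Rightarrow> real) set" where
  "prob_weights I = {w. (\<forall>i\<in>I. 0 \<le> w i) \<and> sum w I = 1}"

text \<open>Weights are unconstrained outside \<open>I\<close>, so \<open>prob_weights I\<close>
  need not be compact. Those vanishing outside \<open>I\<close> form a compact set by Tychonoff's
  theorem, and \<open>cong\<close> reduces the general case to them.\<close>

lemma continuous_attains_min_prob_weights:
  fixes F :: "('i \<Rightarrow> real) \<Rightarrow> real"
  assumes "finite I" "I \<noteq> {}" "continuous_on UNIV F"
    and cong: "\<And>w w'. (\<And>i. i \<in> I \<Longrightarrow> w i = w' i) \<Longrightarrow> F w = F w'"
  shows "\<exists>w\<in>prob_weights I. \<forall>w'\<in>prob_weights I. F w \<le> F w'"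
proof -
  define C where "C = PiE UNIV (\<lambda>i. if i \<in> I then {0..1::real} else {0})"
  define P where "P = C \<inter> (\<lambda>w. sum w I) -` {1}"
  have "compactin (product_topology (\<lambda>_. euclidean) UNIV) C"
    unfolding C_def by (subst compactin_PiE) auto
  then have "compact C"
    by (simp add: euclidean_product_topology)
  moreover have "continuous_on UNIV (\<lambda>w. sum w I :: real)"
    by (intro continuous_on_sum continuous_on_product_coordinates)
  then have "closed ((\<lambda>w. sum w I :: real) -` {1})"
    by (intro closed_vimage) auto
  ultimately have "compact P"
    unfolding P_def by (rule compact_Int_closed)
  obtain i0 where "i0 \<in> I" using assms(2) by blast
  then have "(\<lambda>i. if i = i0 then 1 else 0) \<in> P"
    using assms(1) \<open>i0 \<in> I\<close> by (auto simp: P_def C_def)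
  then have "P \<noteq> {}" by blast
  obtain w where w: "w \<in> P" "\<forall>w'\<in>P. F w \<le> F w'"
    using continuous_attains_inf[OF \<open>compact P\<close> \<open>P \<noteq> {}\<close>] assms(3)
    by (meson continuous_on_subset subset_UNIV)
  have "F w \<le> F w'" if "w' \<in> prob_weights I" for w'
  proof -
    define w'' where "w'' = (\<lambda>i. if i \<in> I then w' i else 0)"
    have "w' i \<le> 1" if "i \<in> I" for i
      using \<open>w' \<in> prob_weights I\<close> that assms(1) member_le_sum[of i I w']
      by (auto simp: prob_weights_def)
    moreover have "sum w'' I = sum w' I" by (simp add: w''_def)
    ultimately have "w'' \<in> P"
      using that by (auto simp: P_def C_def prob_weights_def w''_def)
    moreover have "F w'' = F w'" by (rule cong) (simp add: w''_def)
    ultimately show ?thesis using w by metis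
  qed
  moreover have "w \<in> prob_weights I"
  proof -
    have "w i \<in> {0..1}" if "i \<in> I" for i
    proof -
      have "w i \<in> (if i \<in> I then {0..1::real} else {0})"
        using w(1) unfolding P_def C_def by (blast dest: PiE_mem)
      then show ?thesis using that by simp
    qed
    then show ?thesis using w(1) by (auto simp: P_def prob_weights_def)
  qed
  ultimately show ?thesis by blast
qed

text \<open>A nonzero direction of sum zero has a negative entry, so moving along it preserves the
  total weight and eventually exhausts some weight.\<close>

lemma prob_weights_boundary_point:
  fixes w \<mu> :: "'i \<Rightarrow> real"
  assumes "finite I" "w \<in> prob_weights I" "sum \<mu> I = 0" "\<exists>i\<in>I. \<mu> i \<noteq> 0"
  shows "\<exists>t. (\<lambda>i. w i + t * \<mu> i) \<in> prob_weights I \<and> (\<exists>i\<in>I. w i + t * \<mu> i = 0)"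
proof -
  define A where "A = {i\<in>I. \<mu> i < 0}"
  have "A \<noteq> {}"
  proof
    assume "A = {}"
    then have "\<forall>i\<in>I. 0 \<le> \<mu> i" by (auto simp: A_def not_less)
    then show False using assms sum_nonneg_eq_0_iff[of I \<mu>] by auto
  qed
  have "finite A" using assms by (simp add: A_def)
  \<comment> \<open>The first time at which a decreasing weight reaches zero.\<close>
  define t where "t = Min ((\<lambda>i. w i / - \<mu> i) ` A)"
  have "t \<in> (\<lambda>i. w i / - \<mu> i) ` A"
    unfolding t_def using \<open>finite A\<close> \<open>A \<noteq> {}\<close> by (intro Min_in) auto
  then obtain p where p: "p \<in> A" "t = w p / - \<mu> p" by blast
  have "0 \<le> t" using p assms by (auto simp: A_def prob_weights_def divide_nonneg_neg)
  have "0 \<le> w i + t * \<mu> i" if "i \<in> I" for i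
  proof (cases "i \<in> A")
    case True
    then have "t \<le> w i / - \<mu> i"
      unfolding t_def using \<open>finite A\<close> by (intro Min_le) auto
    then show ?thesis using True by (auto simp: A_def field_simps)
  next
    case False
    then show ?thesis using that assms \<open>0 \<le> t\<close> by (auto simp: A_def prob_weights_def)
  qed
  moreover have "(\<Sum>i\<in>I. w i + t * \<mu> i) = 1"
    using assms by (simp add: sum.distrib flip: sum_distrib_left) (simp add: prob_weights_def)
  moreover have "w p + t * \<mu> p = 0" "p \<in> I" using p by (auto simp: A_def)
  ultimately show ?thesis by (auto simp: prob_weights_def)
qed

section \<open>Deviation of a weighted colouring from balance\<close>

text \<open>Taking \<open>u\<^sub>k\<close> to be the projection of the \<open>k\<close>-th unit vector orthogonal to the all-ones vector,
  this is the \<open>k\<close>-th component of \<open>\<Sum>\<^sub>i w\<^sub>i y\<^sub>i \<otimes> u\<^bsub>c(i)\<^esub>\<close>. Indexing components by a function avoids a type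
  of dimension depending on \<open>r\<close>.\<close>

definition class_deviation ::
  "'i set \<Rightarrow> 'k set \<Rightarrow> ('i \<Rightarrow> 'e::real_vector) \<Rightarrow> ('i \<Rightarrow> 'k) \<Rightarrow> ('i \<Rightarrow> real) \<Rightarrow> 'k \<Rightarrow> 'e" where
  "class_deviation I K y c w k =
     (\<Sum>i\<in>I. (w i * (of_bool (c i = k) - 1 / real (card K))) *\<^sub>R y i)"

lemma class_deviation_add:
  "class_deviation I K y c (\<lambda>i. w i + t * \<mu> i) k =
     class_deviation I K y c w k + t *\<^sub>R class_deviation I K y c \<mu> k"
  unfolding class_deviation_def scaleR_sum_right
  by (simp add: distrib_right scaleR_left_distrib sum.distrib mult.assoc)

lemma class_deviation_eq:
  assumes "finite I"
  shows "class_deviation I K y c w k =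
    (\<Sum>i\<in>{i\<in>I. c i = k}. w i *\<^sub>R y i) - (1 / real (card K)) *\<^sub>R (\<Sum>i\<in>I. w i *\<^sub>R y i)"
proof -
  have "(\<Sum>i\<in>{i\<in>I. c i = k}. w i *\<^sub>R y i) = (\<Sum>i\<in>I. (w i * of_bool (c i = k)) *\<^sub>R y i)"
    using assms by (intro sum.mono_neutral_cong_left) auto
  then show ?thesis
    by (simp add: class_deviation_def right_diff_distrib scaleR_diff_left sum_subtractf scaleR_sum_right
        mult.commute)
qed

text \<open>This reflects that the vectors \<open>u\<^sub>k\<close> sum to zero.\<close>

lemma sum_class_deviation:
  assumes "finite K" "c \<in> I \<rightarrow> K"
  shows "(\<Sum>k\<in>K. class_deviation I K y c w k) = 0"
proof -
  have "(\<Sum>k\<in>K. w i * (of_bool (c i = k) - 1 / real (card K))) = 0" if "i \<in> I" for i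
  proof -
    have "c i \<in> K" using assms that by auto
    then have "(\<Sum>k\<in>K. of_bool (c i = k)) = (1::real)"
      using assms by (simp add: of_bool_def)
    moreover have "card K \<noteq> 0" using assms \<open>c i \<in> K\<close> by auto
    ultimately show ?thesis
      using assms by (simp add: sum_subtractf flip: sum_distrib_left)
  qed
  then show ?thesis
    unfolding class_deviation_def
    by (subst sum.swap) (simp flip: scaleR_sum_left)
qed

text \<open>Pairing with a family \<open>Z\<close> of sum zero cancels the term
  \<open>1 / real (card K)\<close>, so each point meets only the component of its own
  colour.\<close>

lemma sum_inner_class_deviation:
  fixes y :: "'i \<Rightarrow> 'e::real_inner"
  assumes "finite K" "c \<in> I \<rightarrow> K" "(\<Sum>k\<in>K. Z k) = 0"
  shows "(\<Sum>k\<in>K. Z k \<bullet> class_deviation I K y c \<mu> k) = (\<Sum>i\<in>I. \<mu> i * (Z (c i) \<bullet> y i))"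
proof -
  have "(\<Sum>k\<in>K. (\<mu> i * (of_bool (c i = k) - 1 / real (card K))) * (Z k \<bullet> y i)) = \<mu> i * (Z (c i) \<bullet> y i)"
    if "i \<in> I" for i
  proof -
    have "c i \<in> K" using assms that by auto
    then have "(\<Sum>k\<in>K. of_bool (c i = k) * (Z k \<bullet> y i)) = Z (c i) \<bullet> y i"
      using assms by (subst sum.remove[of _ "c i"]) (auto intro!: sum.neutral)
    moreover have "(\<Sum>k\<in>K. Z k \<bullet> y i) = 0"
      using assms(3) by (simp flip: inner_sum_left)
    moreover have "(\<Sum>k\<in>K. (\<mu> i * (of_bool (c i = k) - 1 / real (card K))) * (Z k \<bullet> y i))
      = \<mu> i * ((\<Sum>k\<in>K. of_bool (c i = k) * (Z k \<bullet> y i)) - (\<Sum>k\<in>K. Z k \<bullet> y i) / real (card K))"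
      by (simp add: sum_distrib_left sum_divide_distrib sum_subtractf algebra_simps)
    ultimately show ?thesis by simp
  qed
  then show ?thesis
    unfolding class_deviation_def inner_sum_right inner_scaleR_right
    by (subst sum.swap) simp
qed

section \<open>Minimizers of the squared deviation\<close>

definition deviation_sq ::
  "'i set \<Rightarrow> 'k set \<Rightarrow> ('i \<Rightarrow> 'e::real_inner) \<Rightarrow> ('i \<Rightarrow> 'k) \<Rightarrow> ('i \<Rightarrow> real) \<Rightarrow> real" where
  "deviation_sq I K y c w =
     (\<Sum>k\<in>K. class_deviation I K y c w k \<bullet> class_deviation I K y c w k)"

text \<open>Compactness gives optimal weights \<open>L c\<close> for each colouring. Only the
  restriction of a colouring to \<open>I\<close> matters, which leaves finitely many to
  compare.\<close>

lemma deviation_sq_attains_min: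
  fixes y :: "'i \<Rightarrow> 'e::real_inner"
  assumes "finite I" "I \<noteq> {}" "finite K" "K \<noteq> {}"
  shows "\<exists>c\<in>I \<rightarrow> K. \<exists>w\<in>prob_weights I. \<forall>c'\<in>I \<rightarrow> K. \<forall>w'\<in>prob_weights I.
    deviation_sq I K y c w \<le> deviation_sq I K y c' w'"
proof -
  have "\<exists>w\<in>prob_weights I. \<forall>w'\<in>prob_weights I. deviation_sq I K y c w \<le> deviation_sq I K y c w'" for c
  proof (rule continuous_attains_min_prob_weights)
    show "continuous_on UNIV (deviation_sq I K y c)"
      unfolding deviation_sq_def class_deviation_def
      by (intro continuous_intros continuous_on_product_coordinates)
    show "deviation_sq I K y c w = deviation_sq I K y c w'" if "\<And>i. i \<in> I \<Longrightarrow> w i = w' i" for w w'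
      using that by (simp add: deviation_sq_def class_deviation_def)
  qed (use assms in auto)
  then obtain L where L: "\<And>c. L c \<in> prob_weights I"
    "\<And>c w'. w' \<in> prob_weights I \<Longrightarrow> deviation_sq I K y c (L c) \<le> deviation_sq I K y c w'"
    by metis
  let ?C = "PiE I (\<lambda>_. K)"
  have "finite ?C" "?C \<noteq> {}" using assms by (auto intro: finite_PiE simp: PiE_eq_empty_iff)
  then obtain c where "is_arg_min (\<lambda>c. deviation_sq I K y c (L c)) (\<lambda>c. c \<in> ?C) c"
    using ex_is_arg_min_if_finite by blast
  then have c: "c \<in> ?C"
    "\<And>c'. c' \<in> ?C \<Longrightarrow> deviation_sq I K y c (L c) \<le> deviation_sq I K y c' (L c')"
    by (auto simp: is_arg_min_linorder)
  have "deviation_sq I K y c (L c) \<le> deviation_sq I K y c' w'"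
    if "c' \<in> I \<rightarrow> K" "w' \<in> prob_weights I" for c' w'
  proof -
    have "restrict c' I \<in> ?C" using that by auto
    then have "deviation_sq I K y c (L c) \<le> deviation_sq I K y (restrict c' I) (L (restrict c' I))"
      by (rule c)
    also have "\<dots> \<le> deviation_sq I K y (restrict c' I) w'" by (rule L(2)[OF that(2)])
    also have "\<dots> = deviation_sq I K y c' w'"
      by (simp add: deviation_sq_def class_deviation_def)
    finally show ?thesis .
  qed
  then show ?thesis using c(1) L(1) by blast
qed

text \<open>Moving the weights from \<open>w\<close> towards the point mass at \<open>p\<close>
  cannot decrease the objective. The right-hand side minus the left-hand side is half its derivative
  in that direction.\<close>

lemma deviation_sq_minimizer_inner_ge:
  fixes y :: "'i \<Rightarrow> 'e::real_inner"
  assumes "finite I" "finite K" "c \<in> I \<rightarrow> K" "w \<in> prob_weights I" "p \<in> I"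
    and min: "\<And>w'. w' \<in> prob_weights I \<Longrightarrow> deviation_sq I K y c w \<le> deviation_sq I K y c w'"
  shows "deviation_sq I K y c w \<le> class_deviation I K y c w (c p) \<bullet> y p"
proof -
  define \<mu> where "\<mu> = (\<lambda>i. of_bool (i = p) - w i)"
  let ?Z = "class_deviation I K y c w" and ?D = "class_deviation I K y c \<mu>"
  have Z0: "(\<Sum>k\<in>K. ?Z k) = 0" using assms by (intro sum_class_deviation)
  have sum_of_bool: "(\<Sum>i\<in>I. of_bool (i = p) * g i) = g p" for g :: "'i \<Rightarrow> real"
    using assms by (subst sum.remove[of _ p]) (auto intro!: sum.neutral)
  have dev_t: "(\<lambda>i. w i + t * \<mu> i) \<in> prob_weights I" if "0 < t" "t \<le> 1" for t
  proof -
    have "0 \<le> w i + t * \<mu> i" if "i \<in> I" for i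
    proof -
      have "w i + t * \<mu> i = (1 - t) * w i + t * of_bool (i = p)"
        by (simp add: \<mu>_def algebra_simps)
      also have "\<dots> \<ge> 0" using \<open>0 < t\<close> \<open>t \<le> 1\<close> that assms by (auto simp: prob_weights_def)
      finally show ?thesis .
    qed
    moreover have "sum \<mu> I = 0"
      using assms sum_of_bool[of "\<lambda>_. 1"] by (simp add: \<mu>_def sum_subtractf prob_weights_def)
    ultimately show ?thesis
      using assms by (simp add: prob_weights_def sum.distrib flip: sum_distrib_left)
  qed
  have "0 \<le> 2 * t * (\<Sum>k\<in>K. ?Z k \<bullet> ?D k) + t\<^sup>2 * (\<Sum>k\<in>K. ?D k \<bullet> ?D k)" if "0 < t" "t \<le> 1" for t
  proof -
    have "deviation_sq I K y c (\<lambda>i. w i + t * \<mu> i) =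
      deviation_sq I K y c w + 2 * t * (\<Sum>k\<in>K. ?Z k \<bullet> ?D k) + t\<^sup>2 * (\<Sum>k\<in>K. ?D k \<bullet> ?D k)"
      unfolding deviation_sq_def class_deviation_add
      by (simp add: inner_add_left inner_add_right inner_commute sum.distrib sum_distrib_left
          power2_eq_square algebra_simps)
    then show ?thesis using min[OF dev_t[OF that]] by simp
  qed
  then have "0 \<le> (\<Sum>k\<in>K. ?Z k \<bullet> ?D k)" by (rule nonneg_if_quadratic_nonneg)
  also have "\<dots> = (\<Sum>i\<in>I. \<mu> i * (?Z (c i) \<bullet> y i))"
    using assms Z0 by (intro sum_inner_class_deviation)
  also have "\<dots> = ?Z (c p) \<bullet> y p - (\<Sum>i\<in>I. w i * (?Z (c i) \<bullet> y i))"
    by (simp add: \<mu>_def left_diff_distrib sum_subtractf sum_of_bool)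
  also have "(\<Sum>i\<in>I. w i * (?Z (c i) \<bullet> y i)) = deviation_sq I K y c w"
    unfolding deviation_sq_def by (rule sum_inner_class_deviation[symmetric]) (use assms Z0 in auto)
  finally show ?thesis by simp
qed

section \<open>Existence of a balanced colouring\<close>

text \<open>The components sum to zero, so it suffices to annihilate all but the one at
  \<open>k0\<close>, which takes \<open>(card K - 1) * DIM('e)\<close> scalar equations.\<close>

lemma class_deviation_kernel:
  fixes y :: "'i \<Rightarrow> 'e::euclidean_space"
  assumes "finite I" "finite K" "K \<noteq> {}" "c \<in> I \<rightarrow> K" "(card K - 1) * DIM('e) < card I"
  shows "\<exists>\<mu>. (\<exists>i\<in>I. \<mu> i \<noteq> 0) \<and> (\<forall>k\<in>K. class_deviation I K y c \<mu> k = 0)"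
proof -
  obtain k0 where "k0 \<in> K" using assms by blast
  define E where "E = (K - {k0}) \<times> (Basis :: 'e set)"
  define a where "a = (\<lambda>(k, b) i. (of_bool (c i = k) - 1 / real (card K)) * (y i \<bullet> b))"
  have "finite E" "card E = (card K - 1) * DIM('e)"
    using assms \<open>k0 \<in> K\<close> by (simp_all add: E_def card_cartesian_product)
  then obtain \<mu> where \<mu>: "\<exists>i\<in>I. \<mu> i \<noteq> 0" "\<forall>e\<in>E. (\<Sum>i\<in>I. \<mu> i * a e i) = 0"
    using homogeneous_system_nontrivial_solution[of E I a] assms by auto
  have *: "class_deviation I K y c \<mu> k = 0" if "k \<in> K - {k0}" for k
  proof (rule euclidean_eqI)
    fix b :: 'e assume "b \<in> Basis"
    then have "(\<Sum>i\<in>I. \<mu> i * a (k, b) i) = 0" using \<mu> that by (auto simp: E_def)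
    then show "class_deviation I K y c \<mu> k \<bullet> b = 0 \<bullet> b"
      by (simp add: class_deviation_def a_def inner_sum_left mult.assoc)
  qed
  have "(\<Sum>k\<in>K. class_deviation I K y c \<mu> k) = class_deviation I K y c \<mu> k0"
    using assms \<open>k0 \<in> K\<close> * by (simp add: sum.remove)
  then have "class_deviation I K y c \<mu> k0 = 0"
    using sum_class_deviation[OF assms(2,4)] by metis
  with * \<mu>(1) show ?thesis by blast
qed

text \<open>Here \<open>'e\<close> stands for the space of the lifted points, which is why the bound
  has \<open>DIM('e)\<close> without the \<open>+ 1\<close> of Tverberg's theorem.\<close>

lemma exists_balanced_colouring:
  fixes y :: "'i \<Rightarrow> 'e::euclidean_space"
  assumes "finite I" "finite K" "K \<noteq> {}" "(card K - 1) * DIM('e) < card I"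
  shows "\<exists>c\<in>I \<rightarrow> K. \<exists>w\<in>prob_weights I. \<forall>k\<in>K. class_deviation I K y c w k = 0"
proof -
  have "I \<noteq> {}" using assms by auto
  obtain c w0 where c: "c \<in> I \<rightarrow> K" and w0: "w0 \<in> prob_weights I"
    and min: "\<And>c' w'. c' \<in> I \<rightarrow> K \<Longrightarrow> w' \<in> prob_weights I \<Longrightarrow>
      deviation_sq I K y c w0 \<le> deviation_sq I K y c' w'"
    using deviation_sq_attains_min[OF assms(1) \<open>I \<noteq> {}\<close> assms(2,3), of y] by blast
  define m where "m = deviation_sq I K y c w0"
  have "m \<ge> 0" by (simp add: m_def deviation_sq_def sum_nonneg)
  have no_zero_weight: "0 < w i"
    if "m > 0" "w \<in> prob_weights I" "deviation_sq I K y c w = m" "i \<in> I" for w i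
  proof (rule ccontr)
    assume "\<not> 0 < w i"
    then have "w i = 0" using that by (force simp: prob_weights_def)
    let ?Z = "class_deviation I K y c w"
    have "(\<Sum>k\<in>K. ?Z k) = 0" using assms c by (intro sum_class_deviation)
    \<comment> \<open>These inner products sum to zero, so they cannot all be positive.\<close>
    then have "(\<Sum>k\<in>K. ?Z k \<bullet> y i) = 0" by (simp flip: inner_sum_left)
    then obtain k where k: "k \<in> K" "?Z k \<bullet> y i \<le> 0"
      using sum_pos[OF assms(2,3), of "\<lambda>k. ?Z k \<bullet> y i"] by (metis less_irrefl not_le)
    \<comment> \<open>Recolouring a point of weight zero leaves the deviation unchanged. So
      \<open>c'\<close> with \<open>w\<close> is again a minimizer, yet it violates the first-order
      bound at \<open>i\<close>.\<close>
    define c' where "c' = c(i := k)"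
    have c': "c' \<in> I \<rightarrow> K" using c k by (auto simp: c'_def)
    have dev: "class_deviation I K y c' w = ?Z"
      unfolding class_deviation_def using \<open>w i = 0\<close>
      by (intro ext sum.cong) (auto simp: c'_def)
    then have "deviation_sq I K y c' w = m" using that by (simp add: deviation_sq_def)
    then have "m \<le> class_deviation I K y c' w (c' i) \<bullet> y i"
      using deviation_sq_minimizer_inner_ge[of I K c' w i y] assms c' that min m_def by metis
    then show False using k that dev by (simp add: c'_def)
  qed
  have "m = 0"
  proof (rule ccontr)
    assume "m \<noteq> 0"
    with \<open>m \<ge> 0\<close> have "m > 0" by simp
    let ?Z = "class_deviation I K y c w0"
    have Z0: "(\<Sum>k\<in>K. ?Z k) = 0" using assms c by (intro sum_class_deviation)
    have ge: "m \<le> ?Z (c i) \<bullet> y i" if "i \<in> I" for i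
      using deviation_sq_minimizer_inner_ge[of I K c w0 i y] assms c w0 that min m_def by metis
    have "(\<Sum>i\<in>I. w0 i * (?Z (c i) \<bullet> y i)) = m"
      unfolding m_def deviation_sq_def
      by (rule sum_inner_class_deviation[symmetric]) (use assms c Z0 in auto)
    \<comment> \<open>The values \<open>?Z (c i) \<bullet> y i\<close> are at least \<open>m\<close>
      and their weighted mean is \<open>m\<close>, so equality holds wherever the weight is
      positive, that is, everywhere.\<close>
    then have "(\<Sum>i\<in>I. w0 i * (?Z (c i) \<bullet> y i - m)) = 0"
      using w0 by (simp add: right_diff_distrib sum_subtractf prob_weights_def flip: sum_distrib_right)
    then have "\<forall>i\<in>I. w0 i * (?Z (c i) \<bullet> y i - m) = 0"
      by (subst (asm) sum_nonneg_eq_0_iff) (use assms w0 ge in \<open>auto simp: prob_weights_def\<close>)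
    then have on_hyperplane: "?Z (c i) \<bullet> y i = m" if "i \<in> I" for i
      using no_zero_weight[OF \<open>m > 0\<close> w0] that by (force simp: m_def)
    obtain \<mu> where \<mu>: "\<exists>i\<in>I. \<mu> i \<noteq> 0" "\<forall>k\<in>K. class_deviation I K y c \<mu> k = 0"
      using class_deviation_kernel[OF assms(1-3) c assms(4)] by blast
    \<comment> \<open>Pairing the linear relation with \<open>?Z\<close> turns it into
      \<open>sum \<mu> I * m = 0\<close>, so moving along \<open>\<mu>\<close> preserves the total
      weight.\<close>
    have "0 = (\<Sum>k\<in>K. ?Z k \<bullet> class_deviation I K y c \<mu> k)" using \<mu> by simp
    also have "\<dots> = (\<Sum>i\<in>I. \<mu> i * (?Z (c i) \<bullet> y i))"
      using assms c Z0 by (intro sum_inner_class_deviation)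
    also have "\<dots> = sum \<mu> I * m" by (simp add: on_hyperplane sum_distrib_right)
    finally have "sum \<mu> I = 0" using \<open>m > 0\<close> by simp
    then obtain t p where t: "(\<lambda>i. w0 i + t * \<mu> i) \<in> prob_weights I" "p \<in> I" "w0 p + t * \<mu> p = 0"
      using prob_weights_boundary_point[OF assms(1) w0 _ \<mu>(1)] by blast
    have "deviation_sq I K y c (\<lambda>i. w0 i + t * \<mu> i) = m"
      using \<mu>(2) by (simp add: deviation_sq_def class_deviation_add m_def)
    then show False using no_zero_weight[OF \<open>m > 0\<close> t(1) _ t(2)] t(3) by simp
  qed
  then have "\<forall>k\<in>K. class_deviation I K y c w0 k = 0"
    unfolding m_def deviation_sq_def using assms by (subst (asm) sum_nonneg_eq_0_iff) auto
  with c w0 show ?thesis by blast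
qed

section \<open>Tverberg's theorem\<close>

text \<open>Balance means that every class carries the fraction \<open>1 / r\<close> of the weighted
  sum of the lifted points. The last coordinate gives the class weight \<open>1 / r\<close>, and
  rescaling by \<open>r\<close> exhibits the same point \<open>q\<close> in every hull.\<close>

lemma tverberg:
  fixes x :: "'i \<Rightarrow> 'e::euclidean_space"
  assumes "finite I" "finite K" "K \<noteq> {}" "(card K - 1) * (DIM('e) + 1) < card I"
  shows "\<exists>c\<in>I \<rightarrow> K. (\<Inter>k\<in>K. convex hull (x ` {i\<in>I. c i = k})) \<noteq> {}"
proof -
  define y where "y = (\<lambda>i. (x i, 1::real))"
  define r where "r = real (card K)"
  have "r > 0" using assms by (simp add: r_def card_gt_0_iff)
  obtain c w where c: "c \<in> I \<rightarrow> K" and w: "w \<in> prob_weights I"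
    and bal: "\<And>k. k \<in> K \<Longrightarrow> class_deviation I K y c w k = 0"
    using exists_balanced_colouring[of I K y] assms by auto
  define q where "q = (\<Sum>i\<in>I. w i *\<^sub>R x i)"
  have "q \<in> convex hull (x ` {i\<in>I. c i = k})" if "k \<in> K" for k
  proof -
    let ?A = "{i\<in>I. c i = k}"
    have "(\<Sum>i\<in>?A. w i *\<^sub>R y i) = (1 / r) *\<^sub>R (\<Sum>i\<in>I. w i *\<^sub>R y i)"
      using bal[OF that] class_deviation_eq[OF assms(1), of K y c w k] by (simp add: r_def)
    then have "(\<Sum>i\<in>?A. w i *\<^sub>R x i) = (1 / r) *\<^sub>R q" "sum w ?A = 1 / r"
      using w by (simp_all add: y_def prod_eq_iff fst_sum snd_sum q_def prob_weights_def)
    then have "(\<Sum>i\<in>?A. (r * w i) *\<^sub>R x i) = q" "(\<Sum>i\<in>?A. r * w i) = 1"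
      using \<open>r > 0\<close>
      by (simp_all flip: scaleR_scaleR scaleR_sum_right sum_distrib_left) (simp_all add: scaleR_scaleR)
    moreover have "(\<Sum>i\<in>?A. (r * w i) *\<^sub>R x i) \<in> convex hull (x ` ?A)"
      using assms calculation(2) w \<open>r > 0\<close>
      by (intro convex_sum) (auto simp: prob_weights_def hull_inc)
    ultimately show ?thesis by simp
  qed
  with c show ?thesis by blast
qed

section \<open>Affine images and faces of a simplex\<close>

lemma convex_hull_image_subset_if_affine_map_on:
  assumes "affine_map_on S f" "convex S" "T \<subseteq> S"
  shows "convex hull (f ` T) \<subseteq> f ` (convex hull T)"
proof (rule hull_minimal)
  show "f ` T \<subseteq> f ` (convex hull T)" by (intro image_mono hull_subset)
  have sub: "convex hull T \<subseteq> S" using assms by (simp add: hull_minimal)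
  show "convex (f ` (convex hull T))"
  proof (rule convexI, clarify)
    fix a b and u v :: real
    assume *: "0 \<le> u" "0 \<le> v" "u + v = 1" "a \<in> convex hull T" "b \<in> convex hull T"
    then have "u *\<^sub>R a + v *\<^sub>R b \<in> convex hull T"
      by (intro convexD convex_convex_hull)
    moreover have "f (u *\<^sub>R a + v *\<^sub>R b) = u *\<^sub>R f a + v *\<^sub>R f b"
      using assms(1) * sub unfolding affine_map_on_def by blast
    ultimately show "u *\<^sub>R f a + v *\<^sub>R f b \<in> f ` (convex hull T)"
      by (metis image_eqI)
  qed
qed

text \<open>For subsets of an affinely independent set, the intersection of the hulls is the hull of
  the intersection.\<close>

lemma Inter_convex_hulls_of_independent_empty:
  fixes V :: "'k \<Rightarrow> 'a::euclidean_space set"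
  assumes "\<not> affine_dependent C" "J \<noteq> {}" "\<And>k. k \<in> J \<Longrightarrow> V k \<subseteq> C" "(\<Inter>k\<in>J. V k) = {}"
  shows "(\<Inter>k\<in>J. convex hull V k) = {}"
proof -
  have "\<Union>(V ` J) \<subseteq> C" using assms(3) by blast
  then have "\<not> affine_dependent (\<Union>(V ` J))"
    using assms(1) affine_dependent_subset by blast
  then have "convex hull (\<Inter>(V ` J)) = (\<Inter>T\<in>V ` J. convex hull T)"
    using assms(2) by (intro convex_hull_Inter) auto
  then show ?thesis using assms(4) by simp
qed

section \<open>Tverberg's theorem for vertices with multiplicity\<close>

theorem theorem7p2:
  fixes r j :: nat and N :: int
    and \<Delta> :: "'a::euclidean_space set"
    and f :: "'a \<Rightarrow> real ^ 'd"
  assumes "r \<ge> 2" and "CARD('d) \<ge> 1" and "2 \<le> j" and "j \<le> r"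
    and "real_of_int N + 1 > (real r - 1) / (real j - 1) * (real CARD('d) + 1)"
    and "N simplex \<Delta>"
    and "affine_map_on \<Delta> f"
  shows "\<exists>\<sigma> :: nat \<Rightarrow> 'a set.
           (\<forall>i\<in>{1..r}. \<sigma> i face_of \<Delta>) \<and>
           wise_disjoint j {1..r} \<sigma> \<and>
           (\<Inter>i\<in>{1..r}. f ` \<sigma> i) \<noteq> {}"
proof -
  obtain C where C: "\<not> affine_dependent C" "int (card C) = N + 1" "\<Delta> = convex hull C"
    using assms(6) by (auto simp: simplex_def)
  have "finite C" using C(1) by (rule aff_independent_finite)
  \<comment> \<open>Each vertex receives \<open>j - 1\<close> labelled copies, which may get
    different colours.\<close>
  define I where "I = C \<times> {..<j - 1}"
  have "finite I" using \<open>finite C\<close> by (simp add: I_def)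
  have card: "(card {1..r} - 1) * (DIM(real ^ 'd) + 1) < card I"
  proof -
    have "real_of_int N + 1 = real (card C)" using C(2) by linarith
    then have "(real r - 1) * (real CARD('d) + 1) < real (card C) * (real j - 1)"
      using assms(3,5) by (simp add: field_simps)
    moreover have "real (card I) = real (card C) * (real j - 1)"
      using assms(3) by (simp add: I_def card_cartesian_product)
    moreover have "real ((r - 1) * (CARD('d) + 1)) = (real r - 1) * (real CARD('d) + 1)"
      using assms(1) by (simp only: of_nat_mult of_nat_diff of_nat_add of_nat_1)
    ultimately have "(r - 1) * (CARD('d) + 1) < card I" by (simp only: flip: of_nat_less_iff)
    then show ?thesis by simp
  qed
  obtain c where c: "(\<Inter>k\<in>{1..r}. convex hull ((f \<circ> fst) ` {i\<in>I. c i = k})) \<noteq> {}"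
    using tverberg[OF \<open>finite I\<close> _ _ card, of "f \<circ> fst"] assms(1) by auto
  \<comment> \<open>Forgetting the labels lets a vertex belong to several classes and merges copies
    of the same colour.\<close>
  define V where "V = (\<lambda>k. fst ` {i\<in>I. c i = k})"
  have VC: "V k \<subseteq> C" for k by (auto simp: V_def I_def)
  have "convex hull V k face_of \<Delta>" for k
    using face_of_convex_hull_affine_independent[OF C(1)] VC C(3) by blast
  moreover have "wise_disjoint j {1..r} (\<lambda>k. convex hull V k)"
    unfolding wise_disjoint_def
  proof (intro allI impI)
    fix J :: "nat set" assume J: "J \<subseteq> {1..r}" "card J = j"
    have "finite J" "J \<noteq> {}" using J assms(3) by (auto intro: finite_subset)
    have "v \<notin> (\<Inter>k\<in>J. V k)" for v
    proof
      assume "v \<in> (\<Inter>k\<in>J. V k)"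
      \<comment> \<open>Every class containing \<open>v\<close> is the colour of one of its
        \<open>j - 1\<close> copies, so fewer than \<open>j\<close> classes contain it.\<close>
      then have "J \<subseteq> (\<lambda>s. c (v, s)) ` {..<j - 1}" by (force simp: V_def I_def)
      then have "card J \<le> j - 1" using surj_card_le[of "{..<j - 1}"] by simp
      then show False using J assms(3) by simp
    qed
    then show "(\<Inter>k\<in>J. convex hull V k) = {}"
      using C(1) \<open>J \<noteq> {}\<close> VC by (intro Inter_convex_hulls_of_independent_empty) auto
  qed
  moreover have "convex hull ((f \<circ> fst) ` {i\<in>I. c i = k}) \<subseteq> f ` (convex hull V k)" for k
    using convex_hull_image_subset_if_affine_map_on[OF assms(7), of "V k"] VC[of k] C(3)
    by (force simp: V_def image_comp convex_convex_hull hull_inc)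
  then have "(\<Inter>k\<in>{1..r}. f ` (convex hull V k)) \<noteq> {}" using c by blast
  ultimately show ?thesis by (intro exI[of _ "\<lambda>k. convex hull V k"]) blast
qed

end
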